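(* Let $n\ge1$, and suppose $S_1,\dots,S_t\subseteq\mathbb{F}_2^n$ with $\#S_i\ge2$ for each $i$. (a) If $\sum_{i=1}^tS_i=\mathbb{F}_2^n\setminus\{v\}$ for some $v\in\mathbb{F}_2^n$, then $t\le n-1$. (b) Let $e_1,\dots,e_n$ be the standard basis of $\mathbb{F}_2^n$, $v=\sum_ie_i$, and $S_i=\{0,e_1,\dots,e_n\}$ for $i=1,\dots,n-1$. Then $\sum_{i=1}^{n-1}S_i=\mathbb{F}_2^n\setminus\{v\}$.
   Context: The sumset $\sum_iS_i$ is $\{\sum_is_i: s_i\in S_i\}$. *)

theory Defs
  imports "HOL-Analysis.Finite_Cartesian_Product" "HOL-Library.Z2"
begin

(* The space F_2^n is rendered as bit ^ 'n with n = CARD('n); n >= 1 is automatic. *)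

definition sumset :: "'i set \<Rightarrow> ('i \<Rightarrow> 'a::comm_monoid_add set) \<Rightarrow> 'a set" where
  "sumset I S = {\<Sum>i\<in>I. s i | s. \<forall>i\<in>I. s i \<in> S i}"

end

theory Submission
  imports Defs "HOL-Analysis.Cartesian_Space"
begin

text \<open>
  For part (a), translate so that every \<open>S i\<close> contains \<open>0\<close>, and suppose that \<open>t \<ge> n\<close>. If one can
  choose \<open>d i \<in> S i\<close> spanning the whole space, then the sumset is everything. Otherwise Rado's
  theorem on independent transversals yields a nonempty set \<open>J\<close> of indices such that the sets
  \<open>S i\<close> with \<open>i \<in> J\<close> span a proper subspace of dimension at most \<open>card J\<close>. Restricting the sumset
  to the coset of this subspace through the missing point \<open>v\<close> gives an instance of the same
  problem in smaller dimension, with the contribution of the remaining indices collected in an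
  arbitrary summand \<open>C\<close>.
\<close>

section \<open>Independent transversals of families of sets of vectors\<close>

text \<open>
  Rado's theorem relative to a set \<open>U\<close>, which replaces passing to the quotient by \<open>span U\<close> in
  the Halmos--Vaughan induction.
\<close>

lemma (in finite_dimensional_vector_space) rado_relative:
  assumes "finite I"
    and "\<And>J. J \<subseteq> I \<Longrightarrow> dim (U \<union> (\<Union>i\<in>J. D i)) \<ge> dim U + card J"
  shows "\<exists>d. (\<forall>i\<in>I. d i \<in> D i) \<and> dim (U \<union> d ` I) = dim U + card I"
  using assms
proof (induction "card I" arbitrary: I U rule: less_induct)
  case less
  note rank = less.prems(2)
  \<comment> \<open>Either a nonempty proper subfamily meets the rank bound with equality, and the
    problem splits along it, or every such subfamily has a surplus of at least one dimension, and a
    first vector can be chosen freely.\<close>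
  consider "I = {}"
    | (tight) J where "J \<subset> I" "J \<noteq> {}" "dim (U \<union> (\<Union>i\<in>J. D i)) = dim U + card J"
    | (loose) "I \<noteq> {}"
        "\<And>J. J \<subset> I \<Longrightarrow> J \<noteq> {} \<Longrightarrow> dim (U \<union> (\<Union>i\<in>J. D i)) \<ge> dim U + card J + 1"
  proof (cases "\<exists>J. J \<subset> I \<and> J \<noteq> {} \<and> dim (U \<union> (\<Union>i\<in>J. D i)) = dim U + card J")
    case True
    then show ?thesis using that(2) by blast
  next
    case no_tight: False
    show ?thesis
    proof (cases "I = {}")
      case True
      then show ?thesis by (rule that(1))
    next
      case False
      moreover have "dim (U \<union> (\<Union>i\<in>J. D i)) \<ge> dim U + card J + 1"
        if "J \<subset> I" "J \<noteq> {}" for J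
      proof -
        have "dim (U \<union> (\<Union>i\<in>J. D i)) \<noteq> dim U + card J" using no_tight that by blast
        moreover have "dim (U \<union> (\<Union>i\<in>J. D i)) \<ge> dim U + card J"
          using that(1) by (intro rank) auto
        ultimately show ?thesis by linarith
      qed
      ultimately show ?thesis by (rule that(3))
    qed
  qed
  then show ?case
  proof cases
    case 1
    then show ?thesis by simp
  next
    case tight
    have finJ: "finite J" using tight(1) less.prems(1) finite_subset by blast
    have "card J < card I" using tight(1) less.prems(1) by (simp add: psubset_card_mono)
    from less.hyps[OF this finJ, of U] rank tight(1)
    obtain d where d: "\<forall>i\<in>J. d i \<in> D i" "dim (U \<union> d ` J) = dim U + card J" by blast
    \<comment> \<open>The left set lies in the right one and tightness makes the dimensions agree.
      Hence in ranks over larger index sets the chosen vectors can stand for all of the sets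
      \<open>D i\<close> with \<open>i\<close> in \<open>J\<close>.\<close>
    have span_eq: "span (U \<union> d ` J) = span (U \<union> (\<Union>i\<in>J. D i))"
      using d tight(3) by (intro dim_eq_span) auto
    have "card (I - J) < card I"
      using tight(1,2) less.prems(1) by (intro psubset_card_mono) auto
    moreover have "dim (U \<union> d ` J) + card K \<le> dim (U \<union> d ` J \<union> (\<Union>i\<in>K. D i))"
      if K: "K \<subseteq> I - J" for K
    proof -
      have "card (J \<union> K) = card J + card K"
        using K finJ less.prems(1) by (intro card_Un_disjoint) (auto intro: finite_subset)
      moreover have "dim (U \<union> (\<Union>i\<in>J \<union> K. D i)) \<ge> dim U + card (J \<union> K)"
        using K tight(1) by (intro rank) auto
      moreover have "span (U \<union> d ` J \<union> (\<Union>i\<in>K. D i)) = span (U \<union> (\<Union>i\<in>J \<union> K. D i))"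
        unfolding UN_Un Un_assoc[symmetric] span_Un[of "U \<union> _"] span_eq ..
      then have "dim (U \<union> d ` J \<union> (\<Union>i\<in>K. D i)) = dim (U \<union> (\<Union>i\<in>J \<union> K. D i))"
        by (metis dim_span)
      ultimately show ?thesis using d(2) by linarith
    qed
    ultimately obtain d' where d': "\<forall>i\<in>I - J. d' i \<in> D i"
      "dim (U \<union> d ` J \<union> d' ` (I - J)) = dim (U \<union> d ` J) + card (I - J)"
      using less.hyps[of "I - J" "U \<union> d ` J"] less.prems(1) by blast
    define f where "f i = (if i \<in> J then d i else d' i)" for i
    have "U \<union> f ` I = U \<union> d ` J \<union> d' ` (I - J)"
      using tight(1) by (auto simp: f_def image_iff)
    moreover have "card I = card J + card (I - J)"
      using tight(1) finJ less.prems(1) by (metis card_Diff_subset card_mono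
          le_add_diff_inverse psubset_imp_subset)
    ultimately have "dim (U \<union> f ` I) = dim U + card I"
      using d(2) d'(2) by simp
    moreover have "\<forall>i\<in>I. f i \<in> D i" using d(1) d'(1) by (auto simp: f_def)
    ultimately show ?thesis by blast
  next
    case loose
    then obtain i where i: "i \<in> I" by blast
    have "\<not> D i \<subseteq> span U"
    proof
      assume "D i \<subseteq> span U"
      then have "dim (U \<union> D i) \<le> dim U"
        by (metis dim_span dim_subset le_sup_iff span_superset)
      with rank[of "{i}"] i show False by simp
    qed
    then obtain x where x: "x \<in> D i" "x \<notin> span U" by blast
    then have dimx: "dim (insert x U) = dim U + 1" by (simp add: dim_insert)
    have "card (I - {i}) < card I" using i less.prems(1) by (intro card_Diff1_less)
    \<comment> \<open>As \<open>K\<close> omits \<open>i\<close>, it is a proper subfamily; its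
      surplus dimension pays for adding \<open>x\<close> to \<open>U\<close>.\<close>
    moreover have "dim (insert x U) + card K \<le> dim (insert x U \<union> (\<Union>i\<in>K. D i))"
      if K: "K \<subseteq> I - {i}" for K
    proof (cases "K = {}")
      case False
      have "dim U + card K + 1 \<le> dim (U \<union> (\<Union>i\<in>K. D i))"
        using K i False by (intro loose(2)) auto
      also have "\<dots> \<le> dim (insert x U \<union> (\<Union>i\<in>K. D i))" by (intro dim_subset) auto
      finally show ?thesis using dimx by simp
    qed simp
    ultimately obtain d where d: "\<forall>j\<in>I - {i}. d j \<in> D j"
      "dim (insert x U \<union> d ` (I - {i})) = dim (insert x U) + card (I - {i})"
      using less.hyps[of "I - {i}" "insert x U"] less.prems(1) by blast
    have "U \<union> (d(i := x)) ` I = insert x U \<union> d ` (I - {i})"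
      using i by (auto simp: image_iff)
    moreover have "card I = card (I - {i}) + 1"
      using card.remove[OF less.prems(1) i] by simp
    ultimately have "dim (U \<union> (d(i := x)) ` I) = dim U + card I"
      using d(2) dimx by simp
    moreover have "\<forall>j\<in>I. (d(i := x)) j \<in> D j" using d(1) x(1) by auto
    ultimately show ?thesis by blast
  qed
qed

section \<open>Splitting, translating and spanning with sumsets\<close>

lemma sumset_split:
  assumes "finite I" "J \<subseteq> I"
  shows "sumset I S = {a + b | a b. a \<in> sumset (I - J) S \<and> b \<in> sumset J S}"
proof (intro subset_antisym subsetI)
  fix x assume "x \<in> sumset I S"
  then obtain s where s: "x = (\<Sum>i\<in>I. s i)" "\<forall>i\<in>I. s i \<in> S i" by (auto simp: sumset_def)
  have "x = (\<Sum>i\<in>I - J. s i) + (\<Sum>i\<in>J. s i)"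
    unfolding s(1) by (rule sum.subset_diff[OF assms(2,1)])
  moreover have "(\<Sum>i\<in>I - J. s i) \<in> sumset (I - J) S" "(\<Sum>i\<in>J. s i) \<in> sumset J S"
    using s(2) assms(2) by (auto simp: sumset_def)
  ultimately show "x \<in> {a + b | a b. a \<in> sumset (I - J) S \<and> b \<in> sumset J S}" by blast
next
  fix x assume "x \<in> {a + b | a b. a \<in> sumset (I - J) S \<and> b \<in> sumset J S}"
  then obtain s r where sr: "x = (\<Sum>i\<in>I - J. s i) + (\<Sum>i\<in>J. r i)"
    "\<forall>i\<in>I - J. s i \<in> S i" "\<forall>i\<in>J. r i \<in> S i"
    by (auto simp: sumset_def)
  define f where "f i = (if i \<in> J then r i else s i)" for i
  have "(\<Sum>i\<in>I. f i) = (\<Sum>i\<in>I - J. f i) + (\<Sum>i\<in>J. f i)"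
    by (rule sum.subset_diff[OF assms(2,1)])
  then have "x = (\<Sum>i\<in>I. f i)" unfolding sr(1) by (simp add: f_def)
  moreover have "\<forall>i\<in>I. f i \<in> S i" using sr(2,3) by (simp add: f_def)
  ultimately show "x \<in> sumset I S" by (auto simp: sumset_def)
qed

lemma zero_in_sumset: "(\<And>i. i \<in> I \<Longrightarrow> 0 \<in> S i) \<Longrightarrow> 0 \<in> sumset I S"
  by (auto simp: sumset_def intro!: exI[of _ "\<lambda>_. 0"])

text \<open>With \<open>c i\<close> taken from \<open>S i\<close>, this reduces to summands
  containing \<open>0\<close>, at the cost of one overall translation.\<close>

lemma sumset_translate:
  fixes S :: "'i \<Rightarrow> 'a::ab_group_add set"
  shows "sumset I S = (+) (\<Sum>i\<in>I. c i) ` sumset I (\<lambda>i. (\<lambda>x. x - c i) ` S i)"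
proof (intro subset_antisym subsetI)
  fix x assume "x \<in> sumset I S"
  then obtain s where s: "x = (\<Sum>i\<in>I. s i)" "\<forall>i\<in>I. s i \<in> S i" by (auto simp: sumset_def)
  have "x = (\<Sum>i\<in>I. c i) + (\<Sum>i\<in>I. s i - c i)" by (simp add: s(1) sum_subtractf)
  moreover have "(\<Sum>i\<in>I. s i - c i) \<in> sumset I (\<lambda>i. (\<lambda>x. x - c i) ` S i)"
    using s(2) by (auto simp: sumset_def intro!: exI[of _ "\<lambda>i. s i - c i"])
  ultimately show "x \<in> (+) (\<Sum>i\<in>I. c i) ` sumset I (\<lambda>i. (\<lambda>x. x - c i) ` S i)" by blast
next
  fix x assume "x \<in> (+) (\<Sum>i\<in>I. c i) ` sumset I (\<lambda>i. (\<lambda>x. x - c i) ` S i)"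
  then obtain s where s: "x = (\<Sum>i\<in>I. c i) + (\<Sum>i\<in>I. s i)"
    "\<forall>i\<in>I. s i \<in> (\<lambda>x. x - c i) ` S i"
    by (auto simp: sumset_def)
  have "x = (\<Sum>i\<in>I. c i + s i)" by (simp add: s(1) sum.distrib)
  moreover have "\<forall>i\<in>I. c i + s i \<in> S i" using s(2) by force
  ultimately show "x \<in> sumset I S" by (auto simp: sumset_def)
qed

text \<open>A coefficient in F_2 is 0 or 1, so each term \<open>k *s d i\<close> of a linear
  combination is \<open>0\<close> or \<open>d i\<close>, and both lie in \<open>S i\<close>. Part
  (a) relies on the two-element field here.\<close>

lemma span_subset_sumset_bit:
  fixes S :: "'i \<Rightarrow> (bit ^ 'n::finite) set"
  assumes "finite I" and "\<And>i. i \<in> I \<Longrightarrow> 0 \<in> S i" and "\<And>i. i \<in> I \<Longrightarrow> d i \<in> S i"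
  shows "vec.span (d ` I) \<subseteq> sumset I S"
  using assms
proof (induction I rule: finite_induct)
  case empty
  then show ?case by (simp add: sumset_def)
next
  case (insert i I)
  show ?case
  proof
    fix x assume "x \<in> vec.span (d ` insert i I)"
    then obtain k where k: "x - k *s d i \<in> vec.span (d ` I)"
      by (auto simp: vec.span_breakdown_eq)
    have "x - k *s d i \<in> sumset I S" using k insert by blast
    moreover have "k *s d i \<in> S i"
      using insert.prems[of i] by (cases k) auto
    then have "k *s d i \<in> sumset {i} S"
      by (auto simp: sumset_def intro!: exI[of _ "\<lambda>_. k *s d i"])
    ultimately have "(x - k *s d i) + k *s d i
        \<in> {a + b | a b. a \<in> sumset I S \<and> b \<in> sumset {i} S}" by blast
    then have "(x - k *s d i) + k *s d i \<in> sumset (insert i I) S"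
      using insert.hyps sumset_split[of "insert i I" "{i}" S] by auto
    then show "x \<in> sumset (insert i I) S" by simp
  qed
qed

section \<open>Part (a): sumsets missing exactly one point\<close>

text \<open>The free summand \<open>C\<close> makes the induction on \<open>vec.dim W\<close> close:
  on passing to a smaller subspace, it absorbs the summands that need not lie there.\<close>

lemma sumset_ne_punctured_subspace:
  fixes S :: "'i \<Rightarrow> (bit ^ 'n::finite) set"
  assumes "finite I" "I \<noteq> {}" "vec.subspace W" "vec.dim W \<le> card I" "v \<in> W"
    and "\<And>i. i \<in> I \<Longrightarrow> S i \<subseteq> W"
    and "\<And>i. i \<in> I \<Longrightarrow> 0 \<in> S i"
    and "\<And>i. i \<in> I \<Longrightarrow> S i \<noteq> {0}"
  shows "{c + b | c b. c \<in> C \<and> b \<in> sumset I S} \<noteq> W - {v}"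
  using assms
proof (induction "vec.dim W" arbitrary: W I C v rule: less_induct)
  case less
  note fin = less.prems(1) and sub = less.prems(3) and SW = less.prems(6)
    and zero = less.prems(7) and nz = less.prems(8)
  show ?case
  proof
    assume eq: "{c + b | c b. c \<in> C \<and> b \<in> sumset I S} = W - {v}"
    show False
    \<comment> \<open>Sets \<open>J\<close> whose span is all of \<open>W\<close> are excluded so
      that the dimension really drops. They do not obstruct the rank condition below, where only
      \<open>vec.dim W\<close> indices are kept.\<close>
    proof (cases "\<exists>J\<subseteq>I. J \<noteq> {} \<and> vec.span (\<Union>i\<in>J. S i) \<noteq> W \<and>
        vec.dim (\<Union>i\<in>J. S i) \<le> card J")
      case True
      then obtain J where J: "J \<subseteq> I" "J \<noteq> {}" "vec.span (\<Union>i\<in>J. S i) \<noteq> W"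
        "vec.dim (\<Union>i\<in>J. S i) \<le> card J" by blast
      define W' where "W' = vec.span (\<Union>i\<in>J. S i)"
      have sub': "vec.subspace W'" by (simp add: W'_def)
      have W'W: "W' \<subseteq> W" unfolding W'_def using J(1) SW sub by (intro vec.span_minimal) auto
      have "vec.dim W' < vec.dim W"
        using W'W J(3) sub sub' vec.subspace_dim_equal[of W' W] by (force simp: W'_def)
      moreover have bW': "b \<in> W'" if "b \<in> sumset J S" for b
      proof -
        from that obtain s where s: "b = (\<Sum>i\<in>J. s i)" "\<forall>i\<in>J. s i \<in> S i"
          by (auto simp: sumset_def)
        show ?thesis unfolding s(1) W'_def using s(2) by (intro vec.span_sum vec.span_base) auto
      qed
      \<comment> \<open>The part of the coset \<open>v + W'\<close> reached by the indices outside
        \<open>J\<close>, moved back by \<open>v\<close>; the missing point therefore becomes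
        \<open>0\<close>.\<close>
      define C' where "C' = {c + a - v | c a. c \<in> C \<and> a \<in> sumset (I - J) S \<and> c + a - v \<in> W'}"
      have split: "sumset I S = {a + b | a b. a \<in> sumset (I - J) S \<and> b \<in> sumset J S}"
        by (rule sumset_split[OF fin J(1)])
      have "{c + b | c b. c \<in> C' \<and> b \<in> sumset J S} = W' - {0}"
      proof (intro subset_antisym subsetI)
        fix x assume "x \<in> {c + b | c b. c \<in> C' \<and> b \<in> sumset J S}"
        then obtain c a b where cab: "x = c + a - v + b" "c \<in> C" "a \<in> sumset (I - J) S"
          "c + a - v \<in> W'" "b \<in> sumset J S" by (auto simp: C'_def)
        have "c + (a + b) \<in> {c + b | c b. c \<in> C \<and> b \<in> sumset I S}"
          using cab split by blast
        then have "c + (a + b) \<noteq> v" unfolding eq by simp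
        then have "x \<noteq> 0" unfolding cab(1) by (metis add.assoc diff_add_eq eq_iff_diff_eq_0)
        moreover have "x \<in> W'" using cab bW' vec.subspace_add[OF sub'] by blast
        ultimately show "x \<in> W' - {0}" by simp
      next
        fix x assume x: "x \<in> W' - {0}"
        then have "x + v \<in> W - {v}"
          using W'W less.prems(5) vec.subspace_add[OF sub] by auto
        then obtain c a b where cab: "x + v = c + (a + b)" "c \<in> C" "a \<in> sumset (I - J) S"
          "b \<in> sumset J S" unfolding eq[symmetric] split by blast
        have "c + a - v = x - b" using cab(1) by (simp add: algebra_simps)
        \<comment> \<open>Adding elements of \<open>W'\<close> does not change the coset, so
          filtering \<open>C'\<close> by membership in \<open>W'\<close> discards nothing that is
          needed to reach \<open>x\<close>.\<close>
        moreover have "x - b \<in> W'" using x cab bW' vec.subspace_diff[OF sub'] by blast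
        ultimately have "c + a - v \<in> W'" "x = (c + a - v) + b" by simp_all
        with cab have "c + a - v \<in> C'" unfolding C'_def by blast
        with cab(4) \<open>x = (c + a - v) + b\<close> show "x \<in> {c + b | c b. c \<in> C' \<and> b \<in> sumset J S}" by blast
      qed
      moreover have "S i \<subseteq> W'" if "i \<in> J" for i
        using that vec.span_superset unfolding W'_def by blast
      moreover have "finite J" using J(1) fin by (rule finite_subset)
      moreover have "vec.dim W' \<le> card J" using J(4) by (simp add: W'_def)
      moreover have "0 \<in> S i" "S i \<noteq> {0}" if "i \<in> J" for i using that J(1) zero nz by auto
      ultimately show False
        using less.hyps[of W' J 0 C'] J(2) sub' vec.subspace_0[OF sub'] by blast
    next
      case no_J: False
      \<comment> \<open>With exactly \<open>vec.dim W\<close> indices, an independent transversal is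
        a basis of \<open>W\<close>.\<close>
      obtain I' where I': "I' \<subseteq> I" "card I' = vec.dim W"
        using less.prems(4) obtain_subset_with_card_n by metis
      have finI': "finite I'" using I'(1) fin finite_subset by blast
      have "vec.dim ({} :: (bit ^ 'n) set) + card J \<le> vec.dim ({} \<union> (\<Union>i\<in>J. S i))"
        if "J \<subseteq> I'" for J
      proof (cases "vec.span (\<Union>i\<in>J. S i) = W")
        case False
        have "J = {} \<or> \<not> vec.dim (\<Union>i\<in>J. S i) \<le> card J"
          using no_J False that I'(1) by blast
        then show ?thesis by auto
      next
        case True
        then have "vec.dim (\<Union>i\<in>J. S i) = card I'" using I'(2) by (metis vec.dim_span)
        then show ?thesis using that finI' by (simp add: card_mono)
      qed
      then obtain d where d: "\<forall>i\<in>I'. d i \<in> S i" "vec.dim (d ` I') = vec.dim W"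
        using vec.rado_relative[OF finI', of "{}" S] I'(2) by auto
      have "W = vec.span (d ` I')"
      proof -
        have "d ` I' \<subseteq> W" using d(1) I'(1) SW by blast
        then have "vec.span (d ` I') = vec.span W" using d(2) by (intro vec.dim_eq_span) auto
        then show ?thesis using sub by (simp add: vec.span_eq_iff[THEN iffD2])
      qed
      also have "\<dots> \<subseteq> sumset I' S"
        using d(1) I'(1) zero by (intro span_subset_sumset_bit[OF finI']) auto
      \<comment> \<open>The indices outside \<open>I'\<close> contribute \<open>0\<close>.\<close>
      also have "\<dots> \<subseteq> sumset I S"
      proof -
        have "0 \<in> sumset (I - I') S" using zero by (intro zero_in_sumset) auto
        then show ?thesis
          unfolding sumset_split[OF fin I'(1)] by force
      qed
      finally have W_sub: "W \<subseteq> sumset I S" .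
      \<comment> \<open>A nonzero \<open>w\<close> makes \<open>W - {v}\<close> nonempty, so
        \<open>C\<close> has an element \<open>c\<close>. Adding \<open>0\<close> shows that
        \<open>c\<close> lies in \<open>W\<close>; then \<open>v - c\<close> lies in
        \<open>W\<close>, hence in the sumset, and \<open>v\<close> itself is reached.\<close>
      obtain i where "i \<in> I" using less.prems(2) by blast
      then obtain w where w: "w \<in> W" "w \<noteq> 0" using nz zero SW by blast
      have "v + w \<in> W - {v}" using w less.prems(5) vec.subspace_add[OF sub] by simp
      then obtain c where c: "c \<in> C" unfolding eq[symmetric] by blast
      have "0 \<in> sumset I S" using zero by (intro zero_in_sumset) auto
      then have "c + 0 \<in> W - {v}" unfolding eq[symmetric] using c by blast
      then have "v - c \<in> W" using less.prems(5) vec.subspace_diff[OF sub] by simp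
      then have "c + (v - c) \<in> W - {v}" unfolding eq[symmetric] using c W_sub by blast
      then show False by simp
    qed
  qed
qed

lemma sumset_ne_punctured_space:
  fixes S :: "'i \<Rightarrow> (bit ^ 'n::finite) set"
  assumes "finite I" "CARD('n) \<le> card I" "\<And>i. i \<in> I \<Longrightarrow> card (S i) \<ge> 2"
  shows "sumset I S \<noteq> UNIV - {v}"
proof
  assume eq: "sumset I S = UNIV - {v}"
  have "\<exists>c. \<forall>i\<in>I. c i \<in> S i"
    using assms(3) by (intro bchoice) (metis card.empty ex_in_conv not_numeral_le_zero)
  then obtain c where c: "\<And>i. i \<in> I \<Longrightarrow> c i \<in> S i" by blast
  define T where "T i = (\<lambda>x. x - c i) ` S i" for i
  \<comment> \<open>The total translation becomes a one-point \<open>C\<close>, so the missing point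
    stays \<open>v\<close>.\<close>
  have "{a + b | a b. a \<in> {\<Sum>i\<in>I. c i} \<and> b \<in> sumset I T} = UNIV - {v}"
    using eq unfolding sumset_translate[of I S c] T_def by auto
  moreover have "T i \<noteq> {0}" if "i \<in> I" for i
  proof
    assume "T i = {0}"
    moreover have "card (T i) = card (S i)"
      unfolding T_def by (intro card_image inj_onI) simp
    ultimately show False using assms(3)[OF that] by simp
  qed
  moreover have "0 \<in> T i" if "i \<in> I" for i using c[OF that] by (force simp: T_def)
  moreover have "I \<noteq> {}" using assms(2) by auto
  ultimately show False
    using sumset_ne_punctured_subspace[of I UNIV v T "{\<Sum>i\<in>I. c i}"] assms(1,2)
    by (simp add: vec.dim_UNIV card_cart_basis)
qed

section \<open>Part (b): the extremal example\<close>

text \<open>Compare supports: n-1 summands with at most one nonzero coordinate each cannot produce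
  the all-ones vector, while any other vector is a sum of at most n-1 distinct basis vectors, padded
  with zeros.\<close>

lemma sumset_standard_basis:
  fixes S :: "nat \<Rightarrow> (bit ^ 'n::finite) set"
  assumes S: "\<And>i. i \<in> {1..CARD('n) - 1} \<Longrightarrow> S i = insert 0 (range (\<lambda>j. axis j 1))"
  shows "sumset {1..CARD('n) - 1} S = UNIV - {\<Sum>j\<in>UNIV. axis j 1}"
proof -
  let ?v = "(\<Sum>j\<in>UNIV. axis j 1) :: bit ^ 'n" and ?I = "{1..CARD('n) - 1}"
  have nth_sum_axis: "(\<Sum>j\<in>T. axis j 1 :: bit ^ 'n) $ k = (if k \<in> T then 1 else 0)" for T k
    by (simp add: axis_def if_distrib sum.delta cong: if_cong)
  show ?thesis
  proof (intro subset_antisym subsetI)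
    fix x assume "x \<in> sumset ?I S"
    then obtain s where s: "x = (\<Sum>i\<in>?I. s i)" "\<forall>i\<in>?I. s i \<in> S i" by (auto simp: sumset_def)
    have supp: "card {k. s i $ k \<noteq> 0} \<le> 1" if "i \<in> ?I" for i
    proof -
      from s(2) S that obtain j where "s i = 0 \<or> s i = axis j 1" by blast
      then have "{k. s i $ k \<noteq> 0} \<subseteq> {j}" by (auto simp: axis_def split: if_splits)
      then have "card {k. s i $ k \<noteq> 0} \<le> card {j}" by (intro card_mono) auto
      then show ?thesis by simp
    qed
    have "x \<noteq> ?v"
    proof
      assume "x = ?v"
      then have "x $ k = 1" for k by (simp only: nth_sum_axis) simp
      then have "\<exists>i\<in>?I. s i $ k \<noteq> 0" for k
        unfolding s(1) sum_component by (metis sum.neutral zero_neq_one)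
      then have "UNIV = (\<Union>i\<in>?I. {k. s i $ k \<noteq> 0})" by blast
      then have "CARD('n) \<le> (\<Sum>i\<in>?I. card {k. s i $ k \<noteq> 0})"
        by (metis card_UN_le finite_atLeastAtMost)
      also have "\<dots> \<le> (\<Sum>i\<in>?I. 1)" by (intro sum_mono supp)
      \<comment> \<open>Strict because \<open>CARD('n)\<close> is positive, so the subtraction in
        \<open>?I\<close> does not truncate.\<close>
      also have "\<dots> < CARD('n)" by simp
      finally show False by simp
    qed
    then show "x \<in> UNIV - {?v}" by simp
  next
    fix x assume x: "x \<in> UNIV - {?v}"
    define T where "T = {k. x $ k \<noteq> 0}"
    \<comment> \<open>Nonzero entries in F_2 equal 1, so a vector is determined by its
      support.\<close>
    have xT: "x = (\<Sum>j\<in>T. axis j 1)"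
      by (simp only: vec_eq_iff nth_sum_axis) (auto simp: T_def)
    with x have "T \<subset> UNIV" by auto
    then have "card T < CARD('n)" by (intro psubset_card_mono) auto
    then have "card T \<le> card ?I" by simp
    then obtain K where K: "K \<subseteq> ?I" "card K = card T"
      using obtain_subset_with_card_n by metis
    \<comment> \<open>\<open>h\<close> assigns each basis vector of the support to its own summand;
      summands outside \<open>K\<close> take the value \<open>0\<close>.\<close>
    then obtain h where h: "bij_betw h K T"
      using finite_same_card_bij[of K T] finite_subset by auto
    define s where "s i = (if i \<in> K then axis (h i) 1 else 0 :: bit ^ 'n)" for i
    have "(\<Sum>i\<in>?I. s i) = (\<Sum>i\<in>K. axis (h i) 1)"
      using K(1) by (intro sum.mono_neutral_cong_right) (auto simp: s_def)
    also have "\<dots> = x" unfolding xT by (rule sum.reindex_bij_betw[OF h])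
    finally have "x = (\<Sum>i\<in>?I. s i)" by simp
    moreover have "\<forall>i\<in>?I. s i \<in> S i" using S by (auto simp: s_def)
    ultimately show "x \<in> sumset ?I S" by (auto simp: sumset_def)
  qed
qed

theorem theoremA3:
  "(\<forall>(t::nat) (S :: nat \<Rightarrow> (bit ^ 'n::finite) set).
      (\<forall>i\<in>{1..t}. card (S i) \<ge> 2) \<longrightarrow>
      (\<exists>v. sumset {1..t} S = UNIV - {v}) \<longrightarrow>
      t \<le> CARD('n) - 1) \<and>
   (\<forall>(v :: bit ^ 'n) (S :: nat \<Rightarrow> (bit ^ 'n) set).
      v = (\<Sum>j\<in>UNIV. axis j 1) \<longrightarrow>
      (\<forall>i\<in>{1..CARD('n) - 1}. S i = insert 0 (range (\<lambda>j. axis j 1))) \<longrightarrow>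
      sumset {1..CARD('n) - 1} S = UNIV - {v})"
proof (intro conjI allI impI)
  fix t :: nat and S :: "nat \<Rightarrow> (bit ^ 'n) set"
  assume "\<forall>i\<in>{1..t}. card (S i) \<ge> 2" "\<exists>v. sumset {1..t} S = UNIV - {v}"
  then have "\<not> CARD('n) \<le> card {1..t}"
    using sumset_ne_punctured_space[of "{1..t}" S] by blast
  then show "t \<le> CARD('n) - 1" by simp
next
  fix v :: "bit ^ 'n" and S :: "nat \<Rightarrow> (bit ^ 'n) set"
  assume v: "v = (\<Sum>j\<in>UNIV. axis j 1)"
    and S: "\<forall>i\<in>{1..CARD('n) - 1}. S i = insert 0 (range (\<lambda>j. axis j 1))"
  show "sumset {1..CARD('n) - 1} S = UNIV - {v}"
    unfolding v by (rule sumset_standard_basis) (use S in blast)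
qed

end
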